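(* For every integer $n \geq 1$, there is an injection \[ \Psi : Av_n(3412,4231,45321,54312) \rightarrow Av_n(3412,4321). \]
   Context: A permutation $p = p_1 p_2 \cdots p_n$ of $\{1,\dots,n\}$ (one-line notation) contains a pattern $q = q_1 \cdots q_k$ (a permutation of $\{1,\dots,k\}$ in one-line notation) if there are positions $n_1 < n_2 < \cdots < n_k$ such that, for all $i,j$, $p_{n_i} < p_{n_j}$ if and only if $q_i < q_j$. If $p$ does not contain $q$, then $p$ avoids $q$. For a set $S$ of patterns, $Av_n(S)$ denotes the set of permutations of $\{1,\dots,n\}$ that avoid every pattern in $S$; braces around the listed patterns are omitted. *)

theory Defs
  imports "HOL-Combinatorics.Multiset_Permutations"
begin

(* Permutations and patterns are lists in one-line notation, so the permutations of
   {1,...,n} are permutations_of_set {1..n}.  List positions count from 0; the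
   embedding pos gives the increasing positions of the occurrence. *)

definition contains_pattern :: "nat list \<Rightarrow> nat list \<Rightarrow> bool" where
  "contains_pattern p q \<longleftrightarrow>
     (\<exists>pos :: nat \<Rightarrow> nat.
        strict_mono_on {..<length q} pos \<and>
        (\<forall>i<length q. pos i < length p) \<and>
        (\<forall>i<length q. \<forall>j<length q. p ! pos i < p ! pos j \<longleftrightarrow> q ! i < q ! j))"

definition avoids_pattern :: "nat list \<Rightarrow> nat list \<Rightarrow> bool" where
  "avoids_pattern p q \<longleftrightarrow> \<not> contains_pattern p q"

definition Av :: "nat \<Rightarrow> nat list set \<Rightarrow> nat list set" where
  "Av n S = {p \<in> permutations_of_set {1..n}. \<forall>q\<in>S. avoids_pattern p q}"

end

theory Submission
  imports Defs
begin

text \<open>Call an entry of a permutation middle if it has a larger entry to its left and a smaller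
  entry to its right. The injection keeps the other entries (the left-to-right maxima and
  right-to-left minima) and puts the middle entries into increasing order. This preserves the set of
  middle positions. A permutation avoids 4321 iff its middle entries increase, and a 3412 in the
  image forces one of the four forbidden patterns in the preimage. Finally, a permutation avoiding
  3412 and 4231 is determined by its non-middle entries.

  Permutations are viewed as integer functions on sets of integers, so that the symmetry
  reverse-complement, which fixes 3412 and 4231 and exchanges 45321 with 54312, becomes
  \<open>i \<mapsto> - p (- i)\<close>.\<close>

section \<open>Middle positions of integer functions\<close>

definition middle :: "int set \<Rightarrow> (int \<Rightarrow> int) \<Rightarrow> int set" where
  "middle I f = {i \<in> I. (\<exists>j\<in>I. j < i \<and> f i < f j) \<and> (\<exists>k\<in>I. i < k \<and> f k < f i)}"

lemma middle_subset: "middle I f \<subseteq> I"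
  by (auto simp: middle_def)

text \<open>Reversing positions and values together exchanges the two witnesses: a larger entry on
  the left becomes a smaller entry on the right.\<close>

lemma middle_negate:
  "middle (uminus ` I) (\<lambda>i. - f (- i)) = uminus ` middle I f"
proof (intro equalityI subsetI)
  fix x assume "x \<in> middle (uminus ` I) (\<lambda>i. - f (- i))"
  then have "- x \<in> middle I f"
    by (auto simp: middle_def)
  then show "x \<in> uminus ` middle I f"
    by (metis add.inverse_inverse image_eqI)
qed (auto simp: middle_def)

text \<open>The witness is where \<open>f\<close> is least after \<open>i\<close>. Nothing to its
  right is smaller, so it is not middle. Its value therefore survives sorting of the middle
  entries.\<close>

lemma obtain_minimal_after:
  fixes f :: "int \<Rightarrow> int"
  assumes "finite I" "k \<in> I" "i < k"
  obtains z where "z \<in> I" "i < z" "f z \<le> f k" "z \<notin> middle I f" "\<forall>l\<in>I. i < l \<longrightarrow> f z \<le> f l"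
proof -
  let ?S = "{l \<in> I. i < l}"
  have S: "finite ?S" "?S \<noteq> {}"
    using assms by auto
  have "Min (f ` ?S) \<in> f ` ?S"
    using S by (intro Min_in) auto
  then obtain z where z: "z \<in> ?S" "f z = Min (f ` ?S)"
    by force
  then have least: "f z \<le> f l" if "l \<in> I" "i < l" for l
    using S(1) that by simp
  moreover have "z \<notin> middle I f"
    using z(1) least by (fastforce simp: middle_def)
  ultimately show ?thesis
    using that[of z] least z(1) assms by simp
qed

text \<open>Both sides count the elements of the common image that satisfy \<open>P\<close>.\<close>

lemma card_Collect_image_eq:
  assumes "inj_on f A" "inj_on g A" "f ` A = g ` A"
  shows "card {x \<in> A. P (f x)} = card {x \<in> A. P (g x)}"
proof -
  have "card {x \<in> A. P (h x)} = card {y \<in> h ` A. P y}" if "inj_on h A" for h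
  proof -
    have "h ` {x \<in> A. P (h x)} = {y \<in> h ` A. P y}"
      by auto
    moreover have "inj_on h {x \<in> A. P (h x)}"
      using that by (rule inj_on_subset) auto
    ultimately show ?thesis
      using card_image by fastforce
  qed
  from this[OF assms(1)] this[OF assms(2)] show ?thesis
    using assms(3) by simp
qed

section \<open>Functions avoiding the four patterns, and their recovery from the non-middle
  entries\<close>

locale pattern_free =
  fixes I :: "int set" and p :: "int \<Rightarrow> int"
  assumes fin: "finite I"
    and inj: "inj_on p I"
    and no_3412: "\<And>s t u w. \<lbrakk>s \<in> I; t \<in> I; u \<in> I; w \<in> I; s < t; t < u; u < w;
           p u < p w; p w < p s; p s < p t\<rbrakk> \<Longrightarrow> False"
    and no_4231: "\<And>s t u w. \<lbrakk>s \<in> I; t \<in> I; u \<in> I; w \<in> I; s < t; t < u; u < w;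
           p w < p t; p t < p u; p u < p s\<rbrakk> \<Longrightarrow> False"
    and no_45321: "\<And>r s t u w. \<lbrakk>r \<in> I; s \<in> I; t \<in> I; u \<in> I; w \<in> I; r < s; s < t; t < u; u < w;
           p w < p u; p u < p t; p t < p r; p r < p s\<rbrakk> \<Longrightarrow> False"
    and no_54312: "\<And>r s t u w. \<lbrakk>r \<in> I; s \<in> I; t \<in> I; u \<in> I; w \<in> I; r < s; s < t; t < u; u < w;
           p u < p w; p w < p t; p t < p s; p s < p r\<rbrakk> \<Longrightarrow> False"
begin

lemma finite_middle: "finite (middle I p)"
  using fin middle_subset finite_subset by blast

text \<open>With this symmetry, each statement about small entries to the right yields its mirror
  image by interpretation of the locale.\<close>

lemma pattern_free_negate: "pattern_free (uminus ` I) (\<lambda>i. - p (- i))"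
proof
  show "finite (uminus ` I)"
    using fin by simp
  show "inj_on (\<lambda>i. - p (- i)) (uminus ` I)"
    using inj by (auto simp: inj_on_def)
next
  fix s t u w
  assume "s \<in> uminus ` I" "t \<in> uminus ` I" "u \<in> uminus ` I" "w \<in> uminus ` I"
    "s < t" "t < u" "u < w"
    "- p (- u) < - p (- w)" "- p (- w) < - p (- s)" "- p (- s) < - p (- t)"
  then show False
    using no_3412[of "- w" "- u" "- t" "- s"] by auto
next
  fix s t u w
  assume "s \<in> uminus ` I" "t \<in> uminus ` I" "u \<in> uminus ` I" "w \<in> uminus ` I"
    "s < t" "t < u" "u < w"
    "- p (- w) < - p (- t)" "- p (- t) < - p (- u)" "- p (- u) < - p (- s)"
  then show False
    using no_4231[of "- w" "- u" "- t" "- s"] by auto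
next
  fix r s t u w
  assume "r \<in> uminus ` I" "s \<in> uminus ` I" "t \<in> uminus ` I" "u \<in> uminus ` I" "w \<in> uminus ` I"
    "r < s" "s < t" "t < u" "u < w"
    "- p (- w) < - p (- u)" "- p (- u) < - p (- t)" "- p (- t) < - p (- r)" "- p (- r) < - p (- s)"
  then show False
    using no_54312[of "- w" "- u" "- t" "- s" "- r"] by auto
next
  fix r s t u w
  assume "r \<in> uminus ` I" "s \<in> uminus ` I" "t \<in> uminus ` I" "u \<in> uminus ` I" "w \<in> uminus ` I"
    "r < s" "s < t" "t < u" "u < w"
    "- p (- u) < - p (- w)" "- p (- w) < - p (- t)" "- p (- t) < - p (- s)" "- p (- s) < - p (- r)"
  then show False
    using no_45321[of "- w" "- u" "- t" "- s" "- r"] by auto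
qed

text \<open>At the first position \<open>i\<close> where \<open>p\<close> and \<open>p'\<close> differ, \<open>p\<close> would have to contain
  4231 or 3412; whichever of the two functions is smaller at \<open>i\<close> plays the role of \<open>p\<close>.\<close>

lemma first_difference_not_less:
  assumes image: "p' ` I = p ` I" and middle: "middle I p' = middle I p"
    and off: "\<And>l. l \<in> I \<Longrightarrow> l \<notin> middle I p \<Longrightarrow> p' l = p l"
    and before: "\<And>l. l \<in> I \<Longrightarrow> l < i \<Longrightarrow> p' l = p l"
    and i: "i \<in> I"
  shows "\<not> p i < p' i"
proof
  assume less: "p i < p' i"
  have inj': "inj_on p' I"
    using image fin inj by (metis card_image eq_card_imp_inj_on)
  have iM: "i \<in> middle I p"
    using off[OF i] less by auto
  \<comment> \<open>\<open>i\<close> is middle for \<open>p'\<close> as well; the larger entry on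
    its left lies where \<open>p\<close> and \<open>p'\<close> agree.\<close>
  obtain y where y: "y \<in> I" "y < i" "p' i < p y"
    using iM before unfolding middle[symmetric] by (auto simp: middle_def)
  obtain j where j: "j \<in> I" "p j = p' i"
    using image i by (metis imageE imageI)
  have "i < j"
  proof (rule ccontr)
    assume "\<not> i < j"
    then have "j < i"
      using j less by (cases "j = i") auto
    then show False
      using before[of j] j i inj' by (auto simp: inj_on_def)
  qed
  \<comment> \<open>Otherwise \<open>y, i, j, z\<close> would be a 4231 in \<open>p\<close>.\<close>
  have after_j: "\<not> p z < p i" if "z \<in> I" "j < z" for z
    using no_4231[of y i j z] that y j i \<open>i < j\<close> less by auto
  \<comment> \<open>Equally many positions carry values up to \<open>p i\<close> under
    \<open>p\<close> and under \<open>p'\<close>. Since \<open>i\<close> is one of them only for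
    \<open>p\<close>, some other position \<open>k\<close> must be one only for
    \<open>p'\<close>.\<close>
  have "\<exists>k\<in>I. p' k \<le> p i \<and> p i < p k"
  proof (rule ccontr)
    assume "\<not> ?thesis"
    then have sub: "{k \<in> I. p' k \<le> p i} \<subseteq> {k \<in> I. p k \<le> p i} - {i}"
      using less by auto
    have "card {k \<in> I. p' k \<le> p i} = card {k \<in> I. p k \<le> p i}"
      using card_Collect_image_eq[OF inj' inj image] .
    moreover have "card {k \<in> I. p' k \<le> p i} \<le> card ({k \<in> I. p k \<le> p i} - {i})"
      using sub fin by (intro card_mono) auto
    moreover have "card ({k \<in> I. p k \<le> p i} - {i}) < card {k \<in> I. p k \<le> p i}"
      using i fin by (intro card_Diff1_less) auto
    ultimately show False
      by linarith
  qed
  then obtain k where k: "k \<in> I" "p' k \<le> p i" "p i < p k"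
    by blast
  have "i < k"
    using before[of k] k less by (cases k i rule: linorder_cases) auto
  have kM: "k \<in> middle I p"
    using off[of k] k by fastforce
  \<comment> \<open>The least \<open>p'\<close>-value after \<open>k\<close> sits at a non-middle
    position, so \<open>p\<close> has the same small value there.\<close>
  obtain z where z: "z \<in> I" "k < z" "p z < p i"
  proof -
    obtain z0 where "z0 \<in> I" "k < z0" "p' z0 < p' k"
      using kM unfolding middle[symmetric] by (auto simp: middle_def)
    then obtain z where "z \<in> I" "k < z" "p' z \<le> p' z0" "z \<notin> middle I p'"
      using obtain_minimal_after[OF fin, of z0 k p'] by metis
    then show ?thesis
      using that[of z] off[of z] middle k \<open>p' z0 < p' k\<close> by auto
  qed
  have "z < j"
    using after_j[of z] z j less by (cases z j rule: linorder_cases) auto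
  obtain y2 where y2: "y2 \<in> I" "y2 < k" "p k < p y2"
    using kM by (auto simp: middle_def)
  \<comment> \<open>Otherwise \<open>y', i, k, z\<close> would be a 4231 in \<open>p\<close>. Hence
    \<open>y\<close> lies below \<open>p k\<close>, and \<open>y2\<close>, which exceeds
    \<open>p k\<close>, comes after \<open>i\<close>; then \<open>y, y2, z, j\<close> is a
    3412.\<close>
  have no: "\<not> (y' \<in> I \<and> y' < i \<and> p k < p y')" for y'
    using no_4231[of y' i k z] i k z \<open>i < k\<close> by auto
  have "p y < p k"
    using no[of y] y k inj \<open>i < k\<close> by (metis inj_onD less_irrefl not_less_iff_gr_or_eq order.strict_trans)
  moreover have "i < y2"
    using no[of y2] y2 k by (cases y2 i rule: linorder_cases) auto
  ultimately show False
    using no_3412[of y y2 z j] y y2 z j \<open>z < j\<close> less by auto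
qed

end

text \<open>This is the source of injectivity. The hypotheses are symmetric in \<open>p\<close> and
  \<open>p'\<close>, so the preceding lemma excludes both strict inequalities at the least position
  of disagreement.\<close>

lemma pattern_free_determined_by_nonmiddle:
  assumes "pattern_free I p" "pattern_free I p'"
    and image: "p' ` I = p ` I" and middle: "middle I p' = middle I p"
    and off: "\<And>l. l \<in> I \<Longrightarrow> l \<notin> middle I p \<Longrightarrow> p' l = p l"
    and "i \<in> I"
  shows "p' i = p i"
proof (rule ccontr)
  assume "p' i \<noteq> p i"
  let ?D = "{l \<in> I. p' l \<noteq> p l}"
  have D: "finite ?D" "?D \<noteq> {}"
    using pattern_free.fin[OF assms(1)] \<open>i \<in> I\<close> \<open>p' i \<noteq> p i\<close> by auto
  define m where "m = Min ?D"
  have m: "m \<in> I" "p' m \<noteq> p m"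
    using Min_in[OF D] by (auto simp: m_def)
  have before: "p' l = p l" if "l \<in> I" "l < m" for l
    using Min_le[OF D(1), of l] that by (auto simp: m_def)
  have "\<not> p m < p' m"
    using pattern_free.first_difference_not_less[OF assms(1), of p' m] image middle off before m
    by blast
  moreover have "\<not> p' m < p m"
    using pattern_free.first_difference_not_less[OF assms(2), of p m] image middle off before m
    by metis
  ultimately show False
    using m by linarith
qed

section \<open>Sorting the middle entries\<close>

text \<open>Stated as a relation between \<open>p\<close> and \<open>q\<close> instead of a
  construction, so that it is visibly preserved by negation.\<close>

locale middle_sorting = pattern_free +
  fixes q :: "int \<Rightarrow> int"
  assumes off_middle: "\<And>i. i \<in> I \<Longrightarrow> i \<notin> middle I p \<Longrightarrow> q i = p i"
    and image_middle: "q ` middle I p = p ` middle I p"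
    and increasing: "\<And>i j. i \<in> middle I p \<Longrightarrow> j \<in> middle I p \<Longrightarrow> i < j \<Longrightarrow> q i < q j"
begin

lemma middle_sorting_negate:
  "middle_sorting (uminus ` I) (\<lambda>i. - p (- i)) (\<lambda>i. - q (- i))"
proof -
  interpret neg: pattern_free "uminus ` I" "\<lambda>i. - p (- i)"
    by (rule pattern_free_negate)
  show ?thesis
  proof
    fix i assume "i \<in> uminus ` I" "i \<notin> middle (uminus ` I) (\<lambda>i. - p (- i))"
    then show "- q (- i) = - p (- i)"
      using off_middle[of "- i"] by (force simp: middle_negate)
  next
    show "(\<lambda>i. - q (- i)) ` middle (uminus ` I) (\<lambda>i. - p (- i))
        = (\<lambda>i. - p (- i)) ` middle (uminus ` I) (\<lambda>i. - p (- i))"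
      using arg_cong[OF image_middle, of "image uminus"]
      by (simp add: middle_negate image_image)
  next
    fix i j
    assume "i \<in> middle (uminus ` I) (\<lambda>i. - p (- i))" "j \<in> middle (uminus ` I) (\<lambda>i. - p (- i))"
      "i < j"
    then show "- q (- i) < - q (- j)"
      using increasing[of "- j" "- i"] by (auto simp: middle_negate)
  qed
qed

lemma image_eq: "q ` I = p ` I"
proof -
  have "q ` (I - middle I p) = p ` (I - middle I p)"
    using off_middle by (intro image_cong) auto
  moreover have "I = middle I p \<union> (I - middle I p)"
    using middle_subset by auto
  ultimately show ?thesis
    by (metis image_Un image_middle)
qed

lemma inj_on_q: "inj_on q I"
  using image_eq fin inj by (metis card_image eq_card_imp_inj_on)

text \<open>Sorting moves small values to the front.\<close>

lemma card_small_after: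
  assumes "i \<in> middle I p"
  shows "card {l \<in> middle I p. i \<le> l \<and> q l < c} \<le> card {l \<in> middle I p. i \<le> l \<and> p l < c}"
proof (cases "q i < c")
  case False
  then have "{l \<in> middle I p. i \<le> l \<and> q l < c} = {}"
    using increasing[OF assms] by (force simp: order_le_less)
  then show ?thesis
    by (metis card.empty le0)
next
  case True
  let ?M = "middle I p"
  have split: "card {l \<in> ?M. g l < c} = card {l \<in> ?M. l < i \<and> g l < c} + card {l \<in> ?M. i \<le> l \<and> g l < c}"
    for g :: "int \<Rightarrow> int"
  proof -
    have "{l \<in> ?M. g l < c} = {l \<in> ?M. l < i \<and> g l < c} \<union> {l \<in> ?M. i \<le> l \<and> g l < c}"
      by auto
    then show ?thesis
      using finite_middle by (auto simp: card_Un_disjoint disjoint_iff)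
  qed
  have "inj_on p ?M" "inj_on q ?M"
    using inj inj_on_q middle_subset by (auto intro: inj_on_subset)
  then have "card {l \<in> ?M. p l < c} = card {l \<in> ?M. q l < c}"
    using image_middle by (intro card_Collect_image_eq) auto
  \<comment> \<open>As \<open>q i < c\<close> and \<open>q\<close> increases on middle positions,
    all middle positions before \<open>i\<close> count for \<open>q\<close>. The totals agree, so
    \<open>p\<close> has at least as many from \<open>i\<close> on.\<close>
  moreover have "card {l \<in> ?M. l < i \<and> p l < c} \<le> card {l \<in> ?M. l < i \<and> q l < c}"
    using finite_middle increasing[OF _ assms] True by (intro card_mono) force+
  ultimately show ?thesis
    using split[of p] split[of q] by linarith
qed

text \<open>\<open>i\<close> itself is counted for \<open>q\<close>, so the count for
  \<open>p\<close> is positive.\<close>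

lemma small_after:
  assumes "i \<in> middle I p" "q i < c"
  obtains l where "l \<in> middle I p" "i \<le> l" "p l < c"
proof -
  have "0 < card {l \<in> middle I p. i \<le> l \<and> q l < c}"
    using finite_middle assms by (auto simp: card_gt_0_iff)
  then have "0 < card {l \<in> middle I p. i \<le> l \<and> p l < c}"
    using card_small_after[OF assms(1), of c] by linarith
  then show ?thesis
    using that by (auto simp: card_gt_0_iff)
qed

lemma smaller_after:
  assumes "i \<in> middle I p"
  obtains z where "z \<in> I" "z \<notin> middle I p" "i < z" "p z < q i"
proof -
  \<comment> \<open>The bound \<open>q i + 1\<close> turns the strict inequality of
    \<open>small_after\<close> into \<open>p l \<le> q i\<close>.\<close>
  obtain l where l: "l \<in> middle I p" "i \<le> l" "p l \<le> q i"
    using small_after[OF assms, of "q i + 1"] by auto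
  then obtain k where "k \<in> I" "l < k" "p k < p l"
    by (auto simp: middle_def)
  then show ?thesis
    using obtain_minimal_after[OF fin, of k l p] that l by (metis order.strict_trans1 order.strict_trans2)
qed

lemma larger_before:
  assumes "i \<in> middle I p"
  obtains y where "y \<in> I" "y \<notin> middle I p" "y < i" "q i < p y"
proof -
  interpret neg: middle_sorting "uminus ` I" "\<lambda>i. - p (- i)" "\<lambda>i. - q (- i)"
    by (rule middle_sorting_negate)
  obtain z where "z \<in> uminus ` I" "z \<notin> uminus ` middle I p" "- i < z" "- p (- z) < - q i"
    using neg.smaller_after[of "- i"] assms by (auto simp: middle_negate)
  then show ?thesis
    using that[of "- z"] by (auto simp: image_iff)
qed

text \<open>Witnesses for being middle can be chosen at non-middle positions, where \<open>p\<close>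
  and \<open>q\<close> agree: \<open>smaller_after\<close> and \<open>larger_before\<close> replace
  any middle witness by such a one. Thus \<open>q\<close> alone reveals the middle positions of
  \<open>p\<close>.\<close>

lemma middle_q: "middle I q = middle I p"
proof (intro equalityI subsetI)
  fix i assume "i \<in> middle I p"
  then show "i \<in> middle I q"
    using smaller_after[of i] larger_before[of i] off_middle middle_subset
    unfolding middle_def[of I q] by (smt (verit) mem_Collect_eq subsetD)
next
  fix i assume i: "i \<in> middle I q"
  show "i \<in> middle I p"
  proof (rule ccontr)
    assume ni: "i \<notin> middle I p"
    have iI: "i \<in> I" using i middle_subset by auto
    have qi: "q i = p i" using off_middle iI ni by simp
    obtain j where j: "j \<in> I" "j < i" "q i < q j"
      using i by (auto simp: middle_def)
    obtain k where k: "k \<in> I" "i < k" "q k < q i"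
      using i by (auto simp: middle_def)
    have "\<exists>y\<in>I. y < i \<and> p i < p y"
    proof (cases "j \<in> middle I p")
      case True
      then show ?thesis using larger_before[of j] j qi by (metis order.strict_trans)
    next
      case False
      then show ?thesis using off_middle j qi by metis
    qed
    moreover have "\<exists>z\<in>I. i < z \<and> p z < p i"
    proof (cases "k \<in> middle I p")
      case True
      then show ?thesis using smaller_after[of k] k qi by (metis order.strict_trans)
    next
      case False
      then show ?thesis using off_middle k qi by metis
    qed
    ultimately show False
      using ni iI by (auto simp: middle_def)
  qed
qed

section \<open>Avoidance of 4321 and 3412 after sorting\<close>

text \<open>The two inner entries of a 4321 are middle, but the middle entries of \<open>q\<close>
  increase.\<close>

lemma q_no_4321:
  assumes "{s, t, u, w} \<subseteq> I" "s < t" "t < u" "u < w" "q w < q u" "q u < q t" "q t < q s"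
  shows False
proof -
  have "t \<in> middle I q" "u \<in> middle I q"
    using assms by (force simp: middle_def)+
  then show False
    using increasing[of t u] assms by (simp add: middle_q)
qed

text \<open>The entries playing 3 and 4 are unchanged by sorting. In each case for the lower two,
  suitable small entries of \<open>p\<close> to the right of \<open>t\<close> complete a forbidden
  pattern.\<close>

lemma q_no_3412_upper:
  assumes in_I: "{s, t, u, w} \<subseteq> I" and "s < t" "t < u" "u < w" and "q u < q w" "q w < q s" "q s < q t"
    and upper: "s \<notin> middle I p" "t \<notin> middle I p"
  shows False
proof -
  have p_st: "q s = p s" "q t = p t"
    using off_middle upper in_I by auto
  have lower_not_both: False if "u' \<in> I" "w' \<in> I" "u' \<notin> middle I p" "w' \<notin> middle I p" "t < u'" "u' < w'"
    "q u' < q w'" "q w' < q s" for u' w'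
    using no_3412[of s t u' w'] that p_st off_middle in_I assms by auto
  consider "u \<notin> middle I p" "w \<notin> middle I p" | "u \<notin> middle I p" "w \<in> middle I p"
    | "u \<in> middle I p" "w \<notin> middle I p" | "u \<in> middle I p" "w \<in> middle I p"
    by blast
  then show False
  proof cases
    case 1
    then show False
      using lower_not_both[of u w] assms by auto
  next
    case 2
    obtain l where "l \<in> middle I p" and l: "w \<le> l" "p l < q s"
      using small_after[OF 2(2) \<open>q w < q s\<close>] .
    then have "l \<in> I"
      by (simp add: middle_def)
    \<comment> \<open>\<open>u\<close> is not middle but has the larger entry \<open>t\<close> on
      its left, so nothing smaller follows it. Hence \<open>s, t, u, l\<close> is a 3412 in
      \<open>p\<close>.\<close>
    have "\<not> p l < p u"
      using 2(1) l \<open>l \<in> I\<close> assms off_middle[of u] p_st by (auto simp: middle_def)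
    moreover have "p l \<noteq> p u"
      using inj_on_eq_iff[OF inj \<open>l \<in> I\<close>, of u] l in_I \<open>u < w\<close> by auto
    ultimately show False
      using no_3412[of s t u l] l \<open>l \<in> I\<close> assms p_st by auto
  next
    case 3
    obtain z where z: "z \<in> I" "z \<notin> middle I p" "u < z" "p z < q u"
      using smaller_after[OF 3(1)] .
    then have qz: "q z = p z"
      using off_middle by simp
    \<comment> \<open>If \<open>z\<close> came after \<open>w\<close>, then \<open>s\<close> and
      \<open>z\<close> would make \<open>w\<close> middle for \<open>q\<close>. So \<open>z\<close>
      precedes \<open>w\<close>, and \<open>s, t, z, w\<close> is a 3412 in unchanged
      entries.\<close>
    have "\<not> w < z"
    proof
      assume "w < z"
      then have "w \<in> middle I q"
        unfolding middle_def using z qz assms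
        by (intro CollectI conjI bexI[of _ s] bexI[of _ z]) auto
      then show False
        using 3(2) middle_q by simp
    qed
    moreover have "z \<noteq> w"
      using z qz assms by auto
    ultimately show False
      using lower_not_both[of z w] z qz 3 assms by auto
  next
    case 4
    \<comment> \<open>\<open>q\<close> has two middle entries below \<open>q s\<close> from
      \<open>u\<close> on, so \<open>p\<close> has two as well, at \<open>a < b\<close>.\<close>
    have "card {u, w} \<le> card {l \<in> middle I p. u \<le> l \<and> q l < q s}"
      using finite_middle 4 assms by (intro card_mono) auto
    then have "2 \<le> card {l \<in> middle I p. u \<le> l \<and> p l < q s}"
      using card_small_after[OF 4(1), of "q s"] assms by auto
    then obtain T where "T \<subseteq> {l \<in> middle I p. u \<le> l \<and> p l < q s}" "card T = 2" "finite T"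
      by (rule obtain_subset_with_card_n)
    then obtain a b where "a \<noteq> b" "{a, b} \<subseteq> {l \<in> middle I p. u \<le> l \<and> p l < q s}"
      by (auto simp: card_2_iff)
    then obtain a b where ab: "a < b" "a \<in> middle I p" "b \<in> middle I p" "u \<le> a" "u \<le> b"
        "p a < p s" "p b < p s"
      using p_st by (cases a b rule: linorder_cases) auto
    then have abI: "a \<in> I" "b \<in> I"
      using middle_subset by auto
    have "u \<in> I"
      using in_I by simp
    \<comment> \<open>\<open>z\<close> carries the least \<open>p\<close>-value after
      \<open>t\<close>. Before \<open>b\<close> it would give the 3412 \<open>s, t, z, b\<close>.
      After \<open>b\<close> it gives the 4231 \<open>t, a, b, z\<close> or the 45321
      \<open>s, t, a, b, z\<close>, according to the order of \<open>p a\<close> and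
      \<open>p b\<close>.\<close>
    obtain z where z: "z \<in> I" "t < z" "p z \<le> p u" "z \<notin> middle I p"
        "\<forall>l\<in>I. t < l \<longrightarrow> p z \<le> p l"
      by (rule obtain_minimal_after[OF fin \<open>u \<in> I\<close> \<open>t < u\<close>, of p])
    have below: "p z < p x" if x: "x \<in> middle I p" "u \<le> x" for x
    proof -
      obtain k where k: "k \<in> I" "x < k" "p k < p x"
        using x(1) by (auto simp: middle_def)
      then show ?thesis
        using bspec[OF z(5) k(1)] x(2) \<open>t < u\<close> by simp
    qed
    have zab: "p z < p a" "p z < p b"
      using below ab by auto
    then have "\<not> z < b"
      using no_3412[of s t z b] z abI ab assms p_st by auto
    then have "b < z"
      using z ab by (cases z b rule: linorder_cases) auto
    moreover have "p a \<noteq> p b"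
      using inj_on_eq_iff[OF inj abI] ab by simp
    ultimately show False
      using no_4231[of t a b z] no_45321[of s t a b z] zab z abI ab assms p_st
      by (cases "p a" "p b" rule: linorder_cases) auto
  qed
qed

text \<open>Middle entries of \<open>q\<close> increase, so the upper pair \<open>s, t\<close> and
  the lower pair \<open>u, w\<close> cannot both contain one. A pair free of middle entries is
  handled by \<open>q_no_3412_upper\<close>, the lower pair after negation.\<close>

lemma q_no_3412:
  assumes "{s, t, u, w} \<subseteq> I" "s < t" "t < u" "u < w" "q u < q w" "q w < q s" "q s < q t"
  shows False
proof -
  interpret neg: middle_sorting "uminus ` I" "\<lambda>i. - p (- i)" "\<lambda>i. - q (- i)"
    by (rule middle_sorting_negate)
  have "u \<notin> middle I p \<and> w \<notin> middle I p" if "s \<in> middle I p \<or> t \<in> middle I p"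
    using that increasing[of s u] increasing[of s w] increasing[of t u] increasing[of t w] assms
    by auto
  moreover have "False" if "s \<notin> middle I p" "t \<notin> middle I p"
    using that q_no_3412_upper[of s t u w] assms by auto
  moreover have "False" if "u \<notin> middle I p" "w \<notin> middle I p"
    using that neg.q_no_3412_upper[of "- w" "- u" "- t" "- s"] assms
    by (force simp: middle_negate)
  ultimately show False
    by blast
qed

end

section \<open>Existence of the sorted function\<close>

lemma obtain_increasing_enumeration:
  fixes A :: "'a::linorder set"
  assumes "finite A"
  obtains g where "bij_betw g {..<card A} A" "\<And>i j. i < j \<Longrightarrow> j < card A \<Longrightarrow> g i < g j"
proof
  show "bij_betw (nth (sorted_list_of_set A)) {..<card A} A"
    using assms by (intro bij_betw_nth) auto
  show "sorted_list_of_set A ! i < sorted_list_of_set A ! j" if "i < j" "j < card A" for i j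
    using that strict_sorted_list_of_set[of A] by (auto intro: sorted_wrt_nth_less)
qed

lemma (in pattern_free) ex_middle_sorting: "\<exists>q. middle_sorting I p q"
proof -
  let ?M = "middle I p"
  obtain g where g: "bij_betw g {..<card ?M} ?M" "\<And>i j. i < j \<Longrightarrow> j < card ?M \<Longrightarrow> g i < g j"
    using obtain_increasing_enumeration[OF finite_middle] by metis
  obtain h where h: "bij_betw h {..<card (p ` ?M)} (p ` ?M)"
    "\<And>i j. i < j \<Longrightarrow> j < card (p ` ?M) \<Longrightarrow> h i < h j"
    using obtain_increasing_enumeration[of "p ` ?M"] finite_middle by (metis finite_imageI)
  have card_eq: "card (p ` ?M) = card ?M"
    using inj middle_subset by (meson card_image inj_on_subset)
  \<comment> \<open>\<open>g'\<close> is the rank of a middle position. Below, \<open>q\<close>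
    sends the position of each rank to the middle value \<open>h\<close> of the same rank.\<close>
  define g' where "g' = inv_into {..<card ?M} g"
  have g': "bij_betw g' ?M {..<card ?M}"
    unfolding g'_def using g(1) by (rule bij_betw_inv_into)
  have g'_less: "g' i < card ?M" if "i \<in> ?M" for i
    using that g' by (auto dest: bij_betwE)
  have gg': "g (g' i) = i" if "i \<in> ?M" for i
    using that g(1) by (simp add: g'_def bij_betw_inv_into_right)
  have mono_g': "g' i < g' j" if "i \<in> ?M" "j \<in> ?M" "i < j" for i j
  proof (rule ccontr)
    assume "\<not> g' i < g' j"
    then have "g (g' j) \<le> g (g' i)"
      using g(2)[of "g' j" "g' i"] g'_less[OF that(1)] by (cases "g' i = g' j") auto
    then show False
      using that gg' by simp
  qed
  define q where "q = (\<lambda>i. if i \<in> ?M then h (g' i) else p i)"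
  have "q ` ?M = h ` g' ` ?M"
    by (auto simp: q_def image_image)
  then have "q ` ?M = p ` ?M"
    using g' h(1) card_eq by (simp add: bij_betw_def)
  moreover have "q i < q j" if "i \<in> ?M" "j \<in> ?M" "i < j" for i j
    using that mono_g' h(2) g'_less card_eq by (simp add: q_def)
  ultimately have "middle_sorting I p q"
    by unfold_locales (auto simp: q_def)
  then show ?thesis
    by blast
qed

section \<open>Passage between lists in one-line notation and integer functions\<close>

text \<open>Here \<open>vs\<close> lists the values of the occurrence in increasing order.\<close>

lemma contains_patternI:
  assumes ps: "successively (<) ps" "\<forall>x\<in>set ps. x < length p" and vs: "successively (<) vs"
    and q: "set q \<subseteq> {1..length vs}" and eq: "map (nth p) ps = map (\<lambda>k. vs ! (k - 1)) q"
  shows "contains_pattern p q"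
proof -
  have len: "length ps = length q"
    using arg_cong[OF eq, of length] by simp
  have sorted: "sorted_wrt (<) ps" "sorted_wrt (<) vs"
    using ps(1) vs by (simp_all add: successively_conv_sorted_wrt transp_on_less)
  have less: "vs ! (k - 1) < vs ! (l - 1)" if "k \<in> set q" "l \<in> set q" "k < l" for k l
    using subsetD[OF q that(1)] subsetD[OF q that(2)] that(3)
    by (intro sorted_wrt_nth_less[OF sorted(2)]) auto
  have nth: "p ! (ps ! i) = vs ! (q ! i - 1)" if "i < length q" for i
    using arg_cong[OF eq, of "\<lambda>xs. xs ! i"] that len by simp
  have "p ! (ps ! i) < p ! (ps ! j) \<longleftrightarrow> q ! i < q ! j" if "i < length q" "j < length q" for i j
    using less[of "q ! i" "q ! j"] less[of "q ! j" "q ! i"] that nth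
    by (cases "q ! i" "q ! j" rule: linorder_cases) auto
  moreover have "strict_mono_on {..<length q} (nth ps)"
    using len sorted(1) by (auto simp: strict_mono_on_def intro: sorted_wrt_nth_less)
  moreover have "\<forall>i<length q. ps ! i < length p"
    using ps(2) len by auto
  ultimately show ?thesis
    unfolding contains_pattern_def by blast
qed

lemma contains_pattern_4E:
  assumes "contains_pattern p [a, b, c, d]"
  obtains s t u w where "s < t" "t < u" "u < w" "w < length p"
    "\<forall>i<4. \<forall>j<4. p ! ([s, t, u, w] ! i) < p ! ([s, t, u, w] ! j) \<longleftrightarrow> [a, b, c, d] ! i < [a, b, c, d] ! j"
proof -
  obtain pos where pos: "strict_mono_on {..<4} pos" "\<forall>i<4. pos i < length p"
    "\<forall>i<4. \<forall>j<4. p ! pos i < p ! pos j \<longleftrightarrow> [a, b, c, d] ! i < [a, b, c, d] ! j"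
    using assms by (auto simp: contains_pattern_def eval_nat_numeral)
  have "[pos 0, pos 1, pos 2, pos 3] ! i = pos i" if "i < 4" for i
    using that by (auto simp: eval_nat_numeral less_Suc_eq)
  then show ?thesis
    using pos that[of "pos 0" "pos 1" "pos 2" "pos 3"] by (auto simp: strict_mono_on_def)
qed

lemma Av_permutation:
  assumes "p \<in> Av n S"
  shows "set p = {1..n}" "distinct p" "length p = n"
proof -
  show set: "set p = {1..n}" and dist: "distinct p"
    using assms by (simp_all add: Av_def permutations_of_set_def)
  show "length p = n"
    using distinct_card[OF dist] set by simp
qed

text \<open>Integer positions and values make negation available. Only arguments in
  \<open>{0..<int n}\<close> matter, where \<open>nat\<close> loses nothing.\<close>

abbreviation int_nth :: "nat list \<Rightarrow> int \<Rightarrow> int" where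
  "int_nth p i \<equiv> int (p ! nat i)"

lemma pattern_free_int_nth:
  assumes "p \<in> Av n {[3,4,1,2], [4,2,3,1], [4,5,3,2,1], [5,4,3,1,2]}"
  shows "pattern_free {0..<int n} (int_nth p)"
proof -
  have dist: "distinct p" and len: "length p = n"
    using Av_permutation[OF assms] by auto
  have avoids: "\<not> contains_pattern p [3,4,1,2]" "\<not> contains_pattern p [4,2,3,1]"
    "\<not> contains_pattern p [4,5,3,2,1]" "\<not> contains_pattern p [5,4,3,1,2]"
    using assms by (auto simp: Av_def avoids_pattern_def)
  have no_3412: False
    if "s < t" "t < u" "u < w" "w < length p" "p ! u < p ! w" "p ! w < p ! s" "p ! s < p ! t"
    for s t u w
  proof -
    have "contains_pattern p [3,4,1,2]"
      by (intro contains_patternI[of "[s, t, u, w]" _ "[p ! u, p ! w, p ! s, p ! t]"]) (use that in simp_all)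
    then show False
      using avoids by blast
  qed
  have no_4231: False
    if "s < t" "t < u" "u < w" "w < length p" "p ! w < p ! t" "p ! t < p ! u" "p ! u < p ! s"
    for s t u w
  proof -
    have "contains_pattern p [4,2,3,1]"
      by (intro contains_patternI[of "[s, t, u, w]" _ "[p ! w, p ! t, p ! u, p ! s]"]) (use that in simp_all)
    then show False
      using avoids by blast
  qed
  have no_45321: False
    if "r < s" "s < t" "t < u" "u < w" "w < length p" "p ! w < p ! u" "p ! u < p ! t" "p ! t < p ! r" "p ! r < p ! s"
    for r s t u w
  proof -
    have "contains_pattern p [4,5,3,2,1]"
      by (intro contains_patternI[of "[r, s, t, u, w]" _ "[p ! w, p ! u, p ! t, p ! r, p ! s]"]) (use that in simp_all)
    then show False
      using avoids by blast
  qed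
  have no_54312: False
    if "r < s" "s < t" "t < u" "u < w" "w < length p" "p ! u < p ! w" "p ! w < p ! t" "p ! t < p ! s" "p ! s < p ! r"
    for r s t u w
  proof -
    have "contains_pattern p [5,4,3,1,2]"
      by (intro contains_patternI[of "[r, s, t, u, w]" _ "[p ! u, p ! w, p ! t, p ! s, p ! r]"]) (use that in simp_all)
    then show False
      using avoids by blast
  qed
  show ?thesis
  proof
    show "inj_on (int_nth p) {0..<int n}"
      using dist len by (intro inj_onI) (simp add: nth_eq_iff_index_eq nat_less_iff eq_nat_nat_iff)
  next
    fix s t u w
    assume "s \<in> {0..<int n}" "t \<in> {0..<int n}" "u \<in> {0..<int n}" "w \<in> {0..<int n}"
      "s < t" "t < u" "u < w"
      "int_nth p u < int_nth p w" "int_nth p w < int_nth p s" "int_nth p s < int_nth p t"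
    then show False
      using no_3412[of "nat s" "nat t" "nat u" "nat w"] len by (simp add: nat_less_iff)
  next
    fix s t u w
    assume "s \<in> {0..<int n}" "t \<in> {0..<int n}" "u \<in> {0..<int n}" "w \<in> {0..<int n}"
      "s < t" "t < u" "u < w"
      "int_nth p w < int_nth p t" "int_nth p t < int_nth p u" "int_nth p u < int_nth p s"
    then show False
      using no_4231[of "nat s" "nat t" "nat u" "nat w"] len by (simp add: nat_less_iff)
  next
    fix r s t u w
    assume "r \<in> {0..<int n}" "s \<in> {0..<int n}" "t \<in> {0..<int n}" "u \<in> {0..<int n}" "w \<in> {0..<int n}"
      "r < s" "s < t" "t < u" "u < w"
      "int_nth p w < int_nth p u" "int_nth p u < int_nth p t" "int_nth p t < int_nth p r"
      "int_nth p r < int_nth p s"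
    then show False
      using no_45321[of "nat r" "nat s" "nat t" "nat u" "nat w"] len by (simp add: nat_less_iff)
  next
    fix r s t u w
    assume "r \<in> {0..<int n}" "s \<in> {0..<int n}" "t \<in> {0..<int n}" "u \<in> {0..<int n}" "w \<in> {0..<int n}"
      "r < s" "s < t" "t < u" "u < w"
      "int_nth p u < int_nth p w" "int_nth p w < int_nth p t" "int_nth p t < int_nth p s"
      "int_nth p s < int_nth p r"
    then show False
      using no_54312[of "nat r" "nat s" "nat t" "nat u" "nat w"] len by (simp add: nat_less_iff)
  qed simp
qed

lemma image_int_nth:
  assumes "length p = n"
  shows "int_nth p ` {0..<int n} = int ` set p"
proof -
  have "int_nth p ` int ` {0..<n} = int ` nth p ` {0..<n}"
    by (simp add: image_image)
  then show ?thesis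
    using assms by (simp add: image_int_atLeastLessThan) (metis list.set_map map_nth set_upt)
qed

lemma ex_sorted_list:
  assumes "p \<in> Av n {[3,4,1,2], [4,2,3,1], [4,5,3,2,1], [5,4,3,1,2]}"
  shows "\<exists>q \<in> Av n {[3,4,1,2], [4,3,2,1]}. middle_sorting {0..<int n} (int_nth p) (int_nth q)"
proof -
  interpret pattern_free "{0..<int n}" "int_nth p"
    using assms by (rule pattern_free_int_nth)
  have set_p: "set p = {1..n}" and len: "length p = n"
    using Av_permutation[OF assms] by auto
  obtain q' where q': "middle_sorting {0..<int n} (int_nth p) q'"
    using ex_middle_sorting by blast
  define q where "q = map (\<lambda>i. nat (q' (int i))) [0..<n]"
  have image: "q' ` {0..<int n} = int ` {1..n}"
    using middle_sorting.image_eq[OF q'] image_int_nth[OF len] set_p by simp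
  have q_eq: "int_nth q i = q' i" if "i \<in> {0..<int n}" for i
  proof -
    have "q' i \<in> int ` {1..n}"
      using that image by blast
    then show ?thesis
      using that by (auto simp: q_def)
  qed
  have sorting: "middle_sorting {0..<int n} (int_nth p) (int_nth q)"
  proof -
    interpret sq: middle_sorting "{0..<int n}" "int_nth p" q'
      by (rule q')
    have q_eq': "int_nth q i = q' i" if "i \<in> middle {0..<int n} (int_nth p)" for i
      using q_eq that middle_subset by blast
    show ?thesis
    proof
      show "int_nth q ` middle {0..<int n} (int_nth p) = int_nth p ` middle {0..<int n} (int_nth p)"
        using image_cong[OF refl q_eq', of "middle {0..<int n} (int_nth p)"] sq.image_middle
        by (simp only:)
    qed (use q_eq q_eq' sq.off_middle sq.increasing in auto)
  qed
  then interpret middle_sorting "{0..<int n}" "int_nth p" "int_nth q" .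
  have len_q: "length q = n"
    by (simp add: q_def)
  have "int ` set q = int ` {1..n}"
    using image_int_nth[OF len_q] image_eq image_int_nth[OF len] set_p by simp
  then have set_q: "set q = {1..n}"
    by (simp add: inj_image_eq_iff)
  then have "distinct q"
    using len_q by (simp add: card_distinct)
  have "\<not> contains_pattern q [3,4,1,2]"
  proof
    assume "contains_pattern q [3,4,1,2]"
    then show False
    proof (rule contains_pattern_4E)
      fix s t u w
      assume "s < t" "t < u" "u < w" "w < length q" and ord: "\<forall>i<4. \<forall>j<4.
        q ! ([s, t, u, w] ! i) < q ! ([s, t, u, w] ! j) \<longleftrightarrow> [3, 4, 1, 2] ! i < ([3, 4, 1, 2] ! j :: nat)"
      then show False
        \<comment> \<open>The index pairs follow the values 1, 2, 3, 4 of the pattern, which sit at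
          indices 2, 3, 0, 1.\<close>
        using ord[rule_format, of 2 3] ord[rule_format, of 3 0] ord[rule_format, of 0 1] len_q
          q_no_3412[of "int s" "int t" "int u" "int w"] by auto
    qed
  qed
  moreover have "\<not> contains_pattern q [4,3,2,1]"
  proof
    assume "contains_pattern q [4,3,2,1]"
    then show False
    proof (rule contains_pattern_4E)
      fix s t u w
      assume "s < t" "t < u" "u < w" "w < length q" and ord: "\<forall>i<4. \<forall>j<4.
        q ! ([s, t, u, w] ! i) < q ! ([s, t, u, w] ! j) \<longleftrightarrow> [4, 3, 2, 1] ! i < ([4, 3, 2, 1] ! j :: nat)"
      then show False
        using ord[rule_format, of 3 2] ord[rule_format, of 2 1] ord[rule_format, of 1 0] len_q
          q_no_4321[of "int s" "int t" "int u" "int w"] by auto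
    qed
  qed
  ultimately have "q \<in> Av n {[3,4,1,2], [4,3,2,1]}"
    using set_q \<open>distinct q\<close> by (auto simp: Av_def avoids_pattern_def permutations_of_set_def)
  then show ?thesis
    using sorting by blast
qed

theorem theorem4p3:
  fixes n :: nat
  assumes "n \<ge> 1"
  shows "\<exists>\<Psi> :: nat list \<Rightarrow> nat list.
           inj_on \<Psi> (Av n {[3,4,1,2], [4,2,3,1], [4,5,3,2,1], [5,4,3,1,2]}) \<and>
           \<Psi> ` Av n {[3,4,1,2], [4,2,3,1], [4,5,3,2,1], [5,4,3,1,2]} \<subseteq> Av n {[3,4,1,2], [4,3,2,1]}"
proof -
  let ?A = "Av n {[3,4,1,2], [4,2,3,1], [4,5,3,2,1], [5,4,3,1,2]}"
  let ?I = "{0..<int n}"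
  \<comment> \<open>\<open>\<Psi>\<close> is obtained by choice; being related by
    \<open>middle_sorting\<close> is all that injectivity requires.\<close>
  have "\<forall>p\<in>?A. \<exists>q. q \<in> Av n {[3,4,1,2], [4,3,2,1]} \<and> middle_sorting ?I (int_nth p) (int_nth q)"
    using ex_sorted_list by blast
  from bchoice[OF this] obtain \<Psi> where \<Psi>: "\<And>p. p \<in> ?A \<Longrightarrow> \<Psi> p \<in> Av n {[3,4,1,2], [4,3,2,1]}"
    "\<And>p. p \<in> ?A \<Longrightarrow> middle_sorting ?I (int_nth p) (int_nth (\<Psi> p))"
    by blast
  have "inj_on \<Psi> ?A"
  proof (rule inj_onI)
    fix p p' assume p: "p \<in> ?A" "p' \<in> ?A" and eq: "\<Psi> p = \<Psi> p'"
    have perm: "length x = n \<and> set x = {1..n}" if "x \<in> ?A" for x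
      using Av_permutation[OF that] by auto
    have s: "middle_sorting ?I (int_nth p) (int_nth (\<Psi> p))" "middle_sorting ?I (int_nth p') (int_nth (\<Psi> p))"
      using \<Psi>(2)[OF p(1)] \<Psi>(2)[OF p(2)] eq by simp_all
    \<comment> \<open>Both sets are the middle positions of the common image
      \<open>\<Psi> p\<close>, which likewise fixes all non-middle entries of \<open>p\<close> and
      \<open>p'\<close>.\<close>
    have middle: "middle ?I (int_nth p') = middle ?I (int_nth p)"
      using middle_sorting.middle_q[OF s(1)] middle_sorting.middle_q[OF s(2)] by simp
    have "int_nth p' i = int_nth p i" if "i \<in> ?I" for i
    proof (rule pattern_free_determined_by_nonmiddle[of ?I "int_nth p" "int_nth p'"])
      show "int_nth p' ` ?I = int_nth p ` ?I"
        using image_int_nth[of p n] image_int_nth[of p' n] perm[OF p(1)] perm[OF p(2)] by simp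
      show "int_nth p' l = int_nth p l" if "l \<in> ?I" "l \<notin> middle ?I (int_nth p)" for l
        using middle_sorting.off_middle[OF s(1), of l] middle_sorting.off_middle[OF s(2), of l]
          that middle by simp
    qed (use p middle that pattern_free_int_nth in auto)
    from this[of "int _"] show "p = p'"
      using perm p by (intro nth_equalityI) auto
  qed
  then show ?thesis
    using \<Psi>(1) by blast
qed

end
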